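(* Let $r\in[0,\infty)$. The set $\{m_r\circ R_s:0\le s<1\}$ is the set of extreme points of $\Omega_{\mathrm{sub}}^r$.
   Context: $\mathbb{S}:=\mathbb{R}/\mathbb{Z}$, identified with $[0,1)$ under addition modulo 1. For $t\in\mathbb{R}$, $R_t:\mathbb{S}\to\mathbb{S}$ is $R_t(x)=x-t\pmod 1$. $M(\mathbb{S})$ is the set of Borel probability measures on $\mathbb{S}$, and \[ \Omega_{\mathrm{sub}}^{r}:=\{m\in M(\mathbb{S}):m(R_t(U))\le e^{rt}m(U)\text{ for all }t\in[0,\infty)\text{ and Borel }U\subseteq\mathbb{S}\}, \] a convex set. $m_r$ is the Borel probability measure $m_r(U)=\int_U W_r(t)\,dt$, where $W_r(t)=\frac{r}{1-e^{-r}}e^{-rt}$ for $t\in[0,1)$, with the convention $W_0\equiv 1$. $(m\circ R_s)(U):=m(R_s(U))$. *)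

theory Defs
  imports "HOL-Probability.Probability"
begin

text \<open>The circle \<open>\<real>/\<int>\<close> is modelled on the representatives in \<open>[0,1)\<close>. The bijection
  \<open>[0,1) \<rightarrow> \<real>/\<int>\<close> is continuous but not a homeomorphism; it is still a Borel isomorphism, so
  the Borel sets of the circle are the Borel subsets of \<open>[0,1)\<close>.\<close>

definition circle_borel :: "real measure" where
  "circle_borel = restrict_space borel {0..<1}"

definition circle_measures :: "real measure set" where
  "circle_measures = {m. prob_space m \<and> sets m = sets circle_borel}"

definition rot :: "real \<Rightarrow> real \<Rightarrow> real" where
  "rot t x = frac (x - t)"

definition Omega_sub :: "real \<Rightarrow> real measure set" where
  "Omega_sub r = {m \<in> circle_measures.
     \<forall>t\<ge>0. \<forall>U \<in> sets circle_borel. measure m (rot t ` U) \<le> exp (r * t) * measure m U}"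

definition W :: "real \<Rightarrow> real \<Rightarrow> real" where
  "W r t = (if r = 0 then 1 else r / (1 - exp (- r)) * exp (- r * t))"

definition m_sub :: "real \<Rightarrow> real measure" where
  "m_sub r = density (restrict_space lborel {0..<1}) (\<lambda>t. ennreal (W r t))"

text \<open>\<open>m \<circ> R\<^sub>s\<close>, the measure \<open>U \<mapsto> m (R\<^sub>s U)\<close>.  By default \<open>measure_of\<close> yields the zero
  measure if its argument is not countably additive; \<open>emeasure_comp_rot\<close> below shows that
  this does not happen here.\<close>

definition comp_rot :: "real measure \<Rightarrow> real \<Rightarrow> real measure" where
  "comp_rot m s = measure_of (space circle_borel) (sets circle_borel) (\<lambda>U. emeasure m (rot s ` U))"

text \<open>The type of measures is not a real vector space, so \<open>extreme_point_of\<close> does not apply.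
  The definition below is the same one, with convex combinations of measures taken
  setwise.\<close>

definition extreme_measures :: "'a measure set \<Rightarrow> 'a measure set" where
  "extreme_measures S = {m \<in> S. \<forall>a \<in> S. \<forall>b \<in> S.
     \<not> (a \<noteq> b \<and> (\<exists>u. 0 < u \<and> u < 1 \<and>
          (\<forall>U \<in> sets m. measure m U = (1 - u) * measure a U + u * measure b U)))}"

lemma space_circle_borel [simp]: "space circle_borel = {0..<1}"
  by (simp add: circle_borel_def space_restrict_space)

lemma rot_mem: "rot t x \<in> {0..<1}"
  by (simp add: rot_def frac_lt_1)

lemma rot_rot: "rot s (rot t x) = rot (s + t) x"
proof -
  have "frac (x - t) - s - frac (x - (s + t)) = of_int (\<lfloor>x - (s + t)\<rfloor> - \<lfloor>x - t\<rfloor>)"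
    by (simp add: frac_def)
  then have "frac (x - t) - s - frac (x - (s + t)) \<in> \<int>"
    by (metis Ints_of_int)
  then show ?thesis
    unfolding rot_def by (simp add: frac_unique_iff frac_lt_1)
qed

lemma rot_0: "x \<in> {0..<1} \<Longrightarrow> rot 0 x = x"
  by (simp add: rot_def frac_eq)

lemma measurable_rot: "rot t \<in> measurable circle_borel circle_borel"
proof -
  have "rot t \<in> borel_measurable borel"
    unfolding rot_def frac_def by measurable
  then show ?thesis
    unfolding circle_borel_def
    by (intro measurable_restrict_space3) (use rot_mem in auto)
qed

lemma rot_image_eq:
  assumes "U \<subseteq> {0..<1}"
  shows "rot t ` U = rot (- t) -` U \<inter> {0..<1}"
proof (intro set_eqI iffI)
  fix x assume "x \<in> rot t ` U"
  then show "x \<in> rot (- t) -` U \<inter> {0..<1}"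
    using assms rot_mem by (auto simp: rot_rot rot_0 subset_iff)
next
  fix x assume "x \<in> rot (- t) -` U \<inter> {0..<1}"
  then show "x \<in> rot t ` U"
    by (intro image_eqI[of _ _ "rot (- t) x"]) (auto simp: rot_rot rot_0)
qed

lemma comp_rot_eq_distr:
  assumes "sets m = sets circle_borel"
  shows "comp_rot m s = distr m circle_borel (rot (- s))"
proof -
  have sp: "space m = {0..<1}"
    using sets_eq_imp_space_eq[OF assms] by simp
  show ?thesis
    unfolding comp_rot_def distr_def
  proof (rule measure_of_eq)
    show "sets circle_borel \<subseteq> Pow (space circle_borel)" by (rule sets.space_closed)
    fix U assume "U \<in> sigma_sets (space circle_borel) (sets circle_borel)"
    then have "U \<in> sets circle_borel"
      by (simp only: sets.sigma_sets_eq)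
    then have "U \<subseteq> {0..<1}"
      by (metis sets.sets_into_space space_circle_borel)
    then show "emeasure m (rot s ` U) = emeasure m (rot (- s) -` U \<inter> space m)"
      by (simp add: rot_image_eq sp)
  qed
qed

lemma emeasure_comp_rot:
  assumes "sets m = sets circle_borel" and U: "U \<in> sets circle_borel"
  shows "emeasure (comp_rot m s) U = emeasure m (rot s ` U)"
proof -
  have sp: "space m = {0..<1}"
    using sets_eq_imp_space_eq[OF assms(1)] by simp
  have "rot (- s) \<in> measurable m circle_borel"
    using measurable_rot measurable_cong_sets[OF assms(1) refl] by blast
  moreover have "U \<subseteq> {0..<1}"
    using sets.sets_into_space[OF U] by simp
  ultimately show ?thesis
    using U by (simp add: comp_rot_eq_distr[OF assms(1)] emeasure_distr rot_image_eq sp)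
qed

end

theory Submission
  imports Defs
begin

text \<open>A measure in \<open>\<Omega>\<^sub>s\<^sub>u\<^sub>b\<close> has a density \<open>f\<close> such that \<open>g x = exp (r x) f x\<close> is nondecreasing on \<open>[0,1)\<close>
  and \<open>g \<le> exp r * g 0\<close>, i.e. the extension of \<open>g\<close> by \<open>g (x + 1) = exp r * g x\<close> is nondecreasing on the
  line. Cutting the circle into two arcs and assigning to each arc the increments of \<open>g\<close> on it
  writes the measure as a sum of two of the same kind. For an extreme measure the summands are
  proportional to it, for every cut, so \<open>g\<close> jumps at most once per period; this makes
  the measure a rotation of \<open>m\<^sub>r\<close>. Conversely, a decomposition of a function with a single jump
  per period into two such functions can only be a trivial one.\<close>

subsection \<open>Rotations and Lebesgue measure\<close>

abbreviation unit_lborel :: "real measure" where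
  "unit_lborel \<equiv> restrict_space lborel {0..<1}"

lemma sets_circle_borel: "sets circle_borel = sets unit_lborel"
  by (simp add: circle_borel_def sets_restrict_space)

lemma space_unit_lborel: "space unit_lborel = {0..<1}"
  by (simp add: space_restrict_space)

lemma unit_interval_in_sets: "{0..<1} \<in> sets unit_lborel"
  using sets.top[of unit_lborel] by (simp only: space_unit_lborel)

lemma prob_space_unit_lborel: "prob_space unit_lborel"
  by (rule prob_space_restrict_space) auto

lemma borel_imp_unit_lborel:
  "f \<in> borel_measurable borel \<Longrightarrow> f \<in> borel_measurable unit_lborel"
  by (simp add: measurable_restrict_space1)

lemma measurable_rot_unit_lborel: "rot t \<in> measurable unit_lborel unit_lborel"
  using measurable_rot measurable_cong_sets[OF sets_circle_borel sets_circle_borel] by blast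

text \<open>On \<open>[0,1)\<close> the rotation exchanges two intervals: \<open>[0,\<tau>)\<close>
  moves up by \<open>1 - \<tau>\<close>, the rest moves down by \<open>\<tau>\<close>. Each piece is
  a translation on the line, where Lebesgue measure is invariant.\<close>

lemma nn_integral_rot:
  assumes [measurable]: "f \<in> borel_measurable unit_lborel"
  shows "(\<integral>\<^sup>+x. f (rot t x) \<partial>unit_lborel) = (\<integral>\<^sup>+x. f x \<partial>unit_lborel)"
proof -
  define \<tau> where "\<tau> = frac t"
  have \<tau>: "0 \<le> \<tau>" "\<tau> < 1" by (auto simp: \<tau>_def frac_lt_1)
  have rot: "rot t x = (if x < \<tau> then x - \<tau> + 1 else x - \<tau>)" if "x \<in> {0..<1}" for x
  proof -
    have "x - t - (x - \<tau> + 1) = of_int (- \<lfloor>t\<rfloor> - 1)" "x - t - (x - \<tau>) = of_int (- \<lfloor>t\<rfloor>)"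
      by (simp_all add: \<tau>_def frac_def)
    then have "x - t - (x - \<tau> + 1) \<in> \<int>" "x - t - (x - \<tau>) \<in> \<int>"
      by (metis Ints_of_int)+
    then show ?thesis
      unfolding rot_def using that \<tau> by (auto simp: frac_unique_iff)
  qed
  define F where "F x = f x * indicator {0..<1} x" for x
  have F [measurable]: "F \<in> borel_measurable borel"
    using assms unfolding F_def by (simp add: borel_measurable_restrict_space_iff_ennreal)
  have "(\<integral>\<^sup>+x. f (rot t x) \<partial>unit_lborel) = (\<integral>\<^sup>+x. f (rot t x) * indicator {0..<1} x \<partial>lborel)"
    by (subst nn_integral_restrict_space) auto
  \<comment> \<open>The factor \<open>1 *\<close> puts the translations into the affine form
    expected by \<open>nn_integral_real_affine\<close>.\<close>
  also have "\<dots> = (\<integral>\<^sup>+x. F (1 - \<tau> + 1 * x) * indicator {1-\<tau>..<1} (1 - \<tau> + 1 * x)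
      + F (- \<tau> + 1 * x) * indicator {0..<1-\<tau>} (- \<tau> + 1 * x) \<partial>lborel)"
    using \<tau> by (intro nn_integral_cong) (auto simp: F_def rot indicator_def algebra_simps)
  also have "\<dots> = (\<integral>\<^sup>+x. F (1 - \<tau> + 1 * x) * indicator {1-\<tau>..<1} (1 - \<tau> + 1 * x) \<partial>lborel)
      + (\<integral>\<^sup>+x. F (- \<tau> + 1 * x) * indicator {0..<1-\<tau>} (- \<tau> + 1 * x) \<partial>lborel)"
    by (intro nn_integral_add) measurable
  also have "\<dots> = (\<integral>\<^sup>+x. F x * indicator {1-\<tau>..<1} x \<partial>lborel)
      + (\<integral>\<^sup>+x. F x * indicator {0..<1-\<tau>} x \<partial>lborel)"
    using nn_integral_real_affine[of "\<lambda>x. F x * indicator {1-\<tau>..<1} x" 1 "1 - \<tau>"]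
      nn_integral_real_affine[of "\<lambda>x. F x * indicator {0..<1-\<tau>} x" 1 "- \<tau>"] by simp
  also have "\<dots> = (\<integral>\<^sup>+x. F x * indicator {1-\<tau>..<1} x + F x * indicator {0..<1-\<tau>} x \<partial>lborel)"
    by (intro nn_integral_add[symmetric]) measurable
  also have "\<dots> = (\<integral>\<^sup>+x. f x * indicator {0..<1} x \<partial>lborel)"
    using \<tau> by (intro nn_integral_cong) (auto simp: F_def indicator_def)
  also have "\<dots> = (\<integral>\<^sup>+x. f x \<partial>unit_lborel)"
    by (subst nn_integral_restrict_space) auto
  finally show ?thesis .
qed

lemma distr_rot: "distr unit_lborel unit_lborel (rot t) = unit_lborel"
proof (rule measure_eqI)
  fix A assume "A \<in> sets (distr unit_lborel unit_lborel (rot t))"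
  then have A: "A \<in> sets unit_lborel" by simp
  have "emeasure (distr unit_lborel unit_lborel (rot t)) A
      = (\<integral>\<^sup>+x. indicator A x \<partial>distr unit_lborel unit_lborel (rot t))" using A by simp
  also have "\<dots> = (\<integral>\<^sup>+x. indicator A (rot t x) \<partial>unit_lborel)"
    using A by (intro nn_integral_distr measurable_rot_unit_lborel borel_measurable_indicator) simp
  also have "\<dots> = (\<integral>\<^sup>+x. indicator A x \<partial>unit_lborel)"
    by (intro nn_integral_rot borel_measurable_indicator A)
  also have "\<dots> = emeasure unit_lborel A" using A by simp
  finally show "emeasure (distr unit_lborel unit_lborel (rot t)) A = emeasure unit_lborel A" .
qed simp

lemma AE_rot:
  assumes "AE x in unit_lborel. P x"
  shows "AE x in unit_lborel. P (rot t x)"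
  using AE_distrD[OF measurable_rot_unit_lborel, where P = P, unfolded distr_rot] assms by simp

lemma rot_image_mem_iff:
  assumes "U \<subseteq> {0..<1}" "x \<in> {0..<1}"
  shows "rot t x \<in> rot t ` U \<longleftrightarrow> x \<in> U"
  using assms rot_mem[of t x] by (simp add: rot_image_eq rot_rot rot_0)

lemma sets_rot_image:
  assumes U: "U \<in> sets unit_lborel"
  shows "rot t ` U \<in> sets unit_lborel"
proof -
  have "U \<subseteq> {0..<1}" using sets.sets_into_space[OF U] by (simp add: space_unit_lborel)
  then show ?thesis
    using measurable_sets[OF measurable_rot_unit_lborel U, of "- t"]
    by (simp add: rot_image_eq space_unit_lborel)
qed

text \<open>Change of variables: composing a measure with a rotation composes its density with the
  same rotation, because \<open>rot t\<close> is injective on \<open>[0,1)\<close> and preserves the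
  integral.\<close>

lemma emeasure_density_rot:
  assumes f: "f \<in> borel_measurable unit_lborel" and U: "U \<in> sets unit_lborel"
  shows "emeasure (density unit_lborel f) (rot t ` U)
    = emeasure (density unit_lborel (\<lambda>x. f (rot t x))) U"
proof -
  have sub: "U \<subseteq> {0..<1}" using sets.sets_into_space[OF U] by (simp add: space_unit_lborel)
  note [measurable] = f measurable_rot_unit_lborel sets_rot_image[OF U] U
  have "emeasure (density unit_lborel f) (rot t ` U)
      = (\<integral>\<^sup>+x. f x * indicator (rot t ` U) x \<partial>unit_lborel)"
    by (rule emeasure_density) measurable
  also have "\<dots> = (\<integral>\<^sup>+x. f (rot t x) * indicator (rot t ` U) (rot t x) \<partial>unit_lborel)"
    by (rule nn_integral_rot[symmetric]) measurable
  also have "\<dots> = (\<integral>\<^sup>+x. f (rot t x) * indicator U x \<partial>unit_lborel)"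
    by (intro nn_integral_cong)
      (simp add: space_unit_lborel indicator_def rot_image_mem_iff[OF sub])
  also have "\<dots> = emeasure (density unit_lborel (\<lambda>x. f (rot t x))) U"
    by (rule emeasure_density[symmetric]) measurable
  finally show ?thesis .
qed

subsection \<open>Measures with a quasi-monotone density\<close>

text \<open>Only the values on \<open>[0,1)\<close> enter \<open>profile_measure\<close>; asking for
  monotonicity on the whole line makes measurability immediate. The upper bound is monotonicity
  across the point where the circle closes up.\<close>

definition profile :: "real \<Rightarrow> (real \<Rightarrow> real) \<Rightarrow> bool" where
  "profile r g \<longleftrightarrow> mono g \<and> 0 \<le> g 0 \<and> (\<forall>x. g x \<le> exp r * g 0)"

definition profile_measure :: "real \<Rightarrow> (real \<Rightarrow> real) \<Rightarrow> real measure" where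
  "profile_measure r g = density unit_lborel (\<lambda>x. ennreal (exp (- (r * x)) * g x))"

lemma profile_nonneg: "profile r g \<Longrightarrow> 0 \<le> x \<Longrightarrow> 0 \<le> g x"
  unfolding profile_def by (meson monoD order_trans)

lemma profile_borel [measurable_dest]: "profile r g \<Longrightarrow> g \<in> borel_measurable borel"
  unfolding profile_def by (simp add: borel_measurable_mono)

lemma profile_measurable:
  "profile r g \<Longrightarrow> (\<lambda>x. exp (- (r * x)) * g x) \<in> borel_measurable unit_lborel"
  by (rule borel_imp_unit_lborel, drule profile_borel, measurable)

lemma sets_profile_measure: "sets (profile_measure r g) = sets unit_lborel"
  by (simp add: profile_measure_def)

lemma space_profile_measure: "space (profile_measure r g) = {0..<1}"
  by (simp add: profile_measure_def space_unit_lborel)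

text \<open>Densities over Lebesgue measure are unique up to null sets, and the positive exponential
  factor cancels.\<close>

lemma profile_measure_eq_iff:
  assumes "profile r g" "profile r h"
  shows "profile_measure r g = profile_measure r h \<longleftrightarrow> (AE x in unit_lborel. g x = h x)"
proof -
  interpret prob_space unit_lborel by (rule prob_space_unit_lborel)
  have "profile_measure r g = profile_measure r h \<longleftrightarrow>
     (AE x in unit_lborel. ennreal (exp (- (r * x)) * g x) = ennreal (exp (- (r * x)) * h x))"
    unfolding profile_measure_def using assms
    by (intro density_unique_iff measurable_compose[OF _ measurable_ennreal] profile_measurable)
  also have "\<dots> \<longleftrightarrow> (AE x in unit_lborel. g x = h x)"
    using assms by (intro AE_cong) (simp add: space_unit_lborel profile_nonneg)
  finally show ?thesis .
qed

lemma finite_measure_profile_measure: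
  assumes g: "profile r g" and r: "0 \<le> r"
  shows "finite_measure (profile_measure r g)"
proof (rule finite_measureI)
  interpret prob_space unit_lborel by (rule prob_space_unit_lborel)
  have "exp (- (r * x)) * g x \<le> 1 * (exp r * g 0)" if "0 \<le> x" for x
    using g r that profile_nonneg[OF g that] unfolding profile_def
    by (intro mult_mono) auto
  then have "(\<integral>\<^sup>+x. ennreal (exp (- (r * x)) * g x) \<partial>unit_lborel)
      \<le> (\<integral>\<^sup>+x. ennreal (exp r * g 0) \<partial>unit_lborel)"
    by (intro nn_integral_mono ennreal_leI) (simp add: space_unit_lborel)
  also have "\<dots> < \<infinity>" using emeasure_space_1 by (simp add: ennreal_mult_less_top)
  also have "(\<integral>\<^sup>+x. ennreal (exp (- (r * x)) * g x) \<partial>unit_lborel)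
      = emeasure (profile_measure r g) (space (profile_measure r g))"
    unfolding profile_measure_def space_density
    by (subst emeasure_density[OF measurable_compose[OF profile_measurable[OF g] measurable_ennreal] sets.top])
      (auto intro: nn_integral_cong)
  finally show "emeasure (profile_measure r g) (space (profile_measure r g)) \<noteq> \<infinity>" by simp
qed

lemma profile_lincomb:
  assumes "profile r g" "profile r h" "0 \<le> c" "0 \<le> d"
  shows "profile r (\<lambda>x. c * g x + d * h x)"
  using assms unfolding profile_def
  by (auto intro!: monoI add_mono mult_left_mono simp: monoD distrib_left mult.left_commute)

text \<open>Linearity of the integral in the density. The coefficients are nonnegative because
  \<open>ennreal\<close> truncates negative values; finiteness allows the return to real-valued
  \<open>measure\<close>.\<close>

lemma measure_profile_measure_lincomb:
  assumes g: "profile r g" and h: "profile r h" and r: "0 \<le> r" and cd: "0 \<le> c" "0 \<le> d"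
    and U: "U \<in> sets unit_lborel"
  shows "measure (profile_measure r (\<lambda>x. c * g x + d * h x)) U
    = c * measure (profile_measure r g) U + d * measure (profile_measure r h) U"
proof -
  interpret G: finite_measure "profile_measure r g" by (rule finite_measure_profile_measure[OF g r])
  interpret H: finite_measure "profile_measure r h" by (rule finite_measure_profile_measure[OF h r])
  note p = profile_lincomb[OF g h cd]
  interpret P: finite_measure "profile_measure r (\<lambda>x. c * g x + d * h x)"
    by (rule finite_measure_profile_measure[OF p r])
  note [measurable] = U
  have m [measurable]: "(\<lambda>x. ennreal (exp (- (r * x)) * g x)) \<in> borel_measurable unit_lborel"
     "(\<lambda>x. ennreal (exp (- (r * x)) * h x)) \<in> borel_measurable unit_lborel"
     "(\<lambda>x. ennreal (exp (- (r * x)) * (c * g x + d * h x))) \<in> borel_measurable unit_lborel"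
    by (rule measurable_compose[OF profile_measurable measurable_ennreal], fact)+
  have "emeasure (profile_measure r (\<lambda>x. c * g x + d * h x)) U
     = (\<integral>\<^sup>+x. ennreal (exp (- (r * x)) * (c * g x + d * h x)) * indicator U x \<partial>unit_lborel)"
    unfolding profile_measure_def by (rule emeasure_density) measurable
  also have "\<dots> = (\<integral>\<^sup>+x. ennreal c * (ennreal (exp (- (r * x)) * g x) * indicator U x)
      + ennreal d * (ennreal (exp (- (r * x)) * h x) * indicator U x) \<partial>unit_lborel)"
    using cd g h by (intro nn_integral_cong)
      (simp add: indicator_def space_unit_lborel profile_nonneg ennreal_plus[symmetric]
        ennreal_mult'[symmetric] algebra_simps del: ennreal_plus)
  also have "\<dots> = ennreal c * emeasure (profile_measure r g) U
      + ennreal d * emeasure (profile_measure r h) U"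
    unfolding profile_measure_def
    by (simp add: nn_integral_add nn_integral_cmult emeasure_density)
  finally show ?thesis
    using cd by (simp add: G.emeasure_eq_measure H.emeasure_eq_measure P.emeasure_eq_measure
        ennreal_mult'[symmetric] ennreal_plus[symmetric] del: ennreal_plus)
qed

lemma profile_scale: "profile r g \<Longrightarrow> 0 \<le> c \<Longrightarrow> profile r (\<lambda>x. c * g x)"
  using profile_lincomb[of r g g c 0] by simp

lemma measure_profile_measure_scale:
  assumes "profile r g" "0 \<le> r" "0 \<le> c" "U \<in> sets unit_lborel"
  shows "measure (profile_measure r (\<lambda>x. c * g x)) U = c * measure (profile_measure r g) U"
  using measure_profile_measure_lincomb[of r g g c 0 U] assms by simp

text \<open>Comparing the total masses, both equal to 1, forces \<open>k = 1\<close>.\<close>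

lemma prob_profile_measure_unique:
  assumes g: "profile r g" and h: "profile r h" and r: "0 \<le> r"
    and pg: "prob_space (profile_measure r g)" and ph: "prob_space (profile_measure r h)"
    and k: "0 \<le> k" and eq: "AE x in unit_lborel. g x = k * h x"
  shows "profile_measure r g = profile_measure r h"
proof -
  note p = profile_scale[OF h k]
  have "profile_measure r g = profile_measure r (\<lambda>x. k * h x)"
    using profile_measure_eq_iff[OF g p] eq by simp
  then have "measure (profile_measure r g) {0..<1} = k * measure (profile_measure r h) {0..<1}"
    using measure_profile_measure_scale[OF h r k unit_interval_in_sets] by simp
  then have "k = 1"
    using prob_space.prob_space[OF pg] prob_space.prob_space[OF ph]
    by (simp add: space_profile_measure)
  then show ?thesis using profile_measure_eq_iff[OF g h] eq by simp
qed

text \<open>This is the pointwise form of the inequality defining \<open>Omega_sub\<close>. If the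
  move back by \<open>t\<close> does not pass 0, monotonicity suffices; otherwise each passage
  contributes a factor \<open>exp (- r)\<close>, and one such factor already absorbs the bound
  \<open>exp r * g 0\<close>.\<close>

lemma profile_rot_le:
  assumes g: "profile r g" and r: "0 \<le> r" and t: "0 \<le> t" and x: "0 \<le> x" "x < 1"
  shows "exp (- (r * rot t x)) * g (rot t x) \<le> exp (r * t) * (exp (- (r * x)) * g x)"
proof -
  \<comment> \<open>The number of passages through 0 is \<open>- n\<close>.\<close>
  define n where "n = \<lfloor>x - t\<rfloor>"
  have rot: "rot t x = x - t - of_int n" by (simp add: rot_def frac_def n_def)
  have E: "exp (- (r * rot t x)) = exp (r * t) * exp (- (r * x)) * exp (r * of_int n)"
    by (simp add: rot exp_add[symmetric] algebra_simps)
  have "exp (r * of_int n) * g (rot t x) \<le> g x"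
  proof (cases "n = 0")
    case True
    then show ?thesis using g t rot unfolding profile_def by (simp add: monoD)
  next
    case False
    moreover have "n < 1" using x t by (simp add: n_def floor_less_iff)
    ultimately have "n \<le> -1" by simp
    then have "(of_int n :: real) \<le> -1" by linarith
    then have "r * of_int n \<le> - r" using mult_left_mono[OF _ r, of "of_int n" "-1"] by simp
    then have "exp (r * of_int n) * g (rot t x) \<le> exp (- r) * (exp r * g 0)"
      using g profile_nonneg[OF g] rot_mem[of t x] unfolding profile_def
      by (intro mult_mono) auto
    also have "\<dots> = g 0" by (simp add: exp_minus)
    also have "\<dots> \<le> g x" using g x unfolding profile_def by (simp add: monoD)
    finally show ?thesis .
  qed
  then have "exp (r * t) * exp (- (r * x)) * (exp (r * of_int n) * g (rot t x))
     \<le> exp (r * t) * exp (- (r * x)) * g x" by (intro mult_left_mono) simp_all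
  then show ?thesis unfolding E by (simp add: mult.assoc)
qed

lemma profile_measure_in_Omega:
  assumes g: "profile r g" and r: "0 \<le> r" and p: "prob_space (profile_measure r g)"
  shows "profile_measure r g \<in> Omega_sub r"
  unfolding Omega_sub_def circle_measures_def
proof (intro CollectI conjI allI ballI impI p)
  show "sets (profile_measure r g) = sets circle_borel"
    by (simp add: sets_circle_borel sets_profile_measure)
next
  fix t U assume t: "0 \<le> (t::real)" and "U \<in> sets circle_borel"
  then have U [measurable]: "U \<in> sets unit_lborel" by (simp add: sets_circle_borel)
  interpret prob_space "profile_measure r g" by (rule p)
  have m [measurable]: "(\<lambda>x. ennreal (exp (- (r * x)) * g x)) \<in> borel_measurable unit_lborel"
    by (rule measurable_compose[OF profile_measurable measurable_ennreal], fact)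
  note [measurable] = measurable_compose[OF measurable_rot_unit_lborel m]
  have "emeasure (profile_measure r g) (rot t ` U)
      = emeasure (density unit_lborel (\<lambda>x. ennreal (exp (- (r * rot t x)) * g (rot t x)))) U"
    unfolding profile_measure_def using emeasure_density_rot[OF m U] .
  also have "\<dots> = (\<integral>\<^sup>+x. ennreal (exp (- (r * rot t x)) * g (rot t x)) * indicator U x \<partial>unit_lborel)"
    by (rule emeasure_density) measurable
  also have "\<dots> \<le> (\<integral>\<^sup>+x. ennreal (exp (r * t)) * (ennreal (exp (- (r * x)) * g x) * indicator U x) \<partial>unit_lborel)"
    using profile_rot_le[OF g r t] by (intro nn_integral_mono)
      (auto simp: indicator_def space_unit_lborel ennreal_mult'[symmetric] intro!: ennreal_leI)
  also have "\<dots> = ennreal (exp (r * t)) * emeasure (profile_measure r g) U"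
    unfolding profile_measure_def by (simp add: nn_integral_cmult emeasure_density)
  finally show "measure (profile_measure r g) (rot t ` U) \<le> exp (r * t) * measure (profile_measure r g) U"
    by (simp add: emeasure_eq_measure ennreal_mult'[symmetric])
qed

subsection \<open>Existence of a quasi-monotone density\<close>

lemma rot_in_unit:
  assumes "0 \<le> x" "x < 1" "0 \<le> y" "y < 1"
  shows "rot y x = (if y \<le> x then x - y else x - y + 1)"
  using assms by (auto simp: rot_def frac_unique_iff)

text \<open>Joint measurability in angle and point, for the applications of Fubini below.\<close>

lemma measurable_rot_pair:
  "(\<lambda>p. rot (fst p) (snd p)) \<in> measurable (unit_lborel \<Otimes>\<^sub>M unit_lborel) unit_lborel"
  "(\<lambda>p. rot (- fst p) (snd p)) \<in> measurable (unit_lborel \<Otimes>\<^sub>M unit_lborel) unit_lborel"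
proof -
  have id: "(\<lambda>x. x) \<in> borel_measurable unit_lborel"
    by (rule borel_imp_unit_lborel) measurable
  note fst = measurable_compose[OF measurable_fst id] and snd = measurable_compose[OF measurable_snd id]
  have frac: "frac \<in> borel_measurable (borel :: real measure)"
    unfolding frac_def by measurable
  have "(\<lambda>p. snd p - fst p) \<in> borel_measurable (unit_lborel \<Otimes>\<^sub>M unit_lborel)"
    "(\<lambda>p. snd p - - fst p) \<in> borel_measurable (unit_lborel \<Otimes>\<^sub>M unit_lborel)"
    by (intro borel_measurable_diff borel_measurable_uminus fst snd)+
  from this[THEN measurable_compose, OF frac]
  show "(\<lambda>p. rot (fst p) (snd p)) \<in> measurable (unit_lborel \<Otimes>\<^sub>M unit_lborel) unit_lborel"
    "(\<lambda>p. rot (- fst p) (snd p)) \<in> measurable (unit_lborel \<Otimes>\<^sub>M unit_lborel) unit_lborel"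
    using rot_mem by (auto intro!: measurable_restrict_space2 simp: rot_def frac_lt_1)
qed

lemma Omega_subD:
  assumes "m \<in> Omega_sub r"
  shows "prob_space m" "sets m = sets unit_lborel" "space m = {0..<1}"
    "\<And>t U. 0 \<le> t \<Longrightarrow> U \<in> sets unit_lborel \<Longrightarrow> measure m (rot t ` U) \<le> exp (r * t) * measure m U"
proof -
  show "prob_space m" and s: "sets m = sets unit_lborel"
    using assms by (auto simp: Omega_sub_def circle_measures_def sets_circle_borel)
  show "space m = {0..<1}" using sets_eq_imp_space_eq[OF s] by (simp add: space_unit_lborel)
  show "\<And>t U. 0 \<le> t \<Longrightarrow> U \<in> sets unit_lborel \<Longrightarrow> measure m (rot t ` U) \<le> exp (r * t) * measure m U"
    using assms by (auto simp: Omega_sub_def sets_circle_borel)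
qed

text \<open>By Fubini, the average over \<open>t\<close> of \<open>m (R\<^sub>t U)\<close> is the Lebesgue measure of \<open>U\<close>. If it vanishes
  then \<open>m (R\<^sub>t U) = 0\<close> for some \<open>t\<close>, and \<open>R\<^bsub>1-t\<^esub>\<close> carries \<open>R\<^sub>t U\<close> back to \<open>U\<close>.\<close>

lemma Omega_sub_absolutely_continuous:
  assumes m: "m \<in> Omega_sub r"
  shows "absolutely_continuous unit_lborel m"
  unfolding absolutely_continuous_def
proof
  interpret L: prob_space unit_lborel by (rule prob_space_unit_lborel)
  interpret m: prob_space m by (rule Omega_subD(1)[OF m])
  interpret P: pair_sigma_finite m unit_lborel ..
  note sm = Omega_subD(2)[OF m]
  fix U assume "U \<in> null_sets unit_lborel"
  then have U [measurable]: "U \<in> sets unit_lborel" and U0: "emeasure unit_lborel U = 0" by auto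
  have Um: "U \<in> sets m" using U sm by simp
  have sub: "U \<subseteq> {0..<1}" using sets.sets_into_space[OF U] by (simp add: space_unit_lborel)
  \<comment> \<open>Both \<open>rot (- t) x\<close> and \<open>rot (- x) t\<close> are
    \<open>x + t\<close> modulo 1. The second form makes \<open>t\<close> the rotated variable, so
    that after Fubini the inner integral over \<open>t\<close> is rotation invariant.\<close>
  have rm: "emeasure m (rot t ` U) = (\<integral>\<^sup>+x. indicator U (rot (- x) t) \<partial>m)" for t
  proof -
    have "emeasure m (rot t ` U) = (\<integral>\<^sup>+x. indicator (rot t ` U) x \<partial>m)"
      using sets_rot_image[OF U] sm by simp
    also have "\<dots> = (\<integral>\<^sup>+x. indicator U (rot (- x) t) \<partial>m)"
      using Omega_subD(3)[OF m]
      by (intro nn_integral_cong)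
        (simp add: rot_image_eq[OF sub] indicator_def, simp add: rot_def add.commute)
    finally show ?thesis .
  qed
  have "sets (m \<Otimes>\<^sub>M unit_lborel) = sets (unit_lborel \<Otimes>\<^sub>M unit_lborel)"
    using sm by (intro sets_pair_measure_cong) auto
  then have rp: "(\<lambda>p. rot (- fst p) (snd p)) \<in> measurable (m \<Otimes>\<^sub>M unit_lborel) unit_lborel"
    using measurable_rot_pair(2) measurable_cong_sets by blast
  have meas: "(\<lambda>(x, t). indicator U (rot (- x) t) :: ennreal) \<in> borel_measurable (m \<Otimes>\<^sub>M unit_lborel)"
    using measurable_compose[OF rp borel_measurable_indicator[OF U]] by (simp add: case_prod_beta')
  have "(\<integral>\<^sup>+t. emeasure m (rot t ` U) \<partial>unit_lborel)
      = (\<integral>\<^sup>+t. (\<integral>\<^sup>+x. indicator U (rot (- x) t) \<partial>m) \<partial>unit_lborel)" by (simp add: rm)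
  also have "\<dots> = (\<integral>\<^sup>+x. (\<integral>\<^sup>+t. indicator U (rot (- x) t) \<partial>unit_lborel) \<partial>m)"
    by (rule P.Fubini'[OF meas])
  also have "\<dots> = 0" using U0 U by (simp add: nn_integral_rot)
  finally have "(\<integral>\<^sup>+t. emeasure m (rot t ` U) \<partial>unit_lborel) = 0" .
  moreover have "(\<lambda>t. emeasure m (rot t ` U)) \<in> borel_measurable unit_lborel"
    unfolding rm using P.borel_measurable_nn_integral_fst
    by (intro m.borel_measurable_nn_integral) (use measurable_compose[OF measurable_pair_swap' meas] in \<open>simp add: case_prod_beta'\<close>)
  ultimately have "AE t in unit_lborel. emeasure m (rot t ` U) = 0"
    by (simp add: nn_integral_0_iff_AE)
  \<comment> \<open>The bound \<open>t < 1\<close> is carried along so that \<open>1 - t\<close> is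
    an admissible nonnegative angle.\<close>
  then have "AE t in unit_lborel. t < 1 \<and> emeasure m (rot t ` U) = 0"
    by (rule AE_mp) (auto simp: space_unit_lborel)
  then obtain t where t: "t < 1" "emeasure m (rot t ` U) = 0"
    using L.ae_filter_bot by (metis (mono_tags, lifting) eventually_happens')
  have "rot (1 - t) ` rot t ` U = U"
  proof -
    have "rot (1 - t) (rot t x) = x" if "x \<in> U" for x
      using that sub by (auto simp: rot_rot) (simp add: rot_def frac_unique_iff subset_iff)
    then show ?thesis by (simp add: image_image)
  qed
  then have "measure m U \<le> exp (r * (1 - t)) * measure m (rot t ` U)"
    using Omega_subD(4)[OF m, of "1 - t" "rot t ` U"] t sets_rot_image[OF U] by simp
  then have "measure m U \<le> 0" using t by (simp add: m.emeasure_eq_measure)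
  then have "emeasure m U = 0"
    using measure_nonneg[of m U] by (simp add: m.emeasure_eq_measure)
  then show "U \<in> null_sets m" using Um by auto
qed

lemma set_integral_eq_measure_density:
  fixes D :: "'a \<Rightarrow> real"
  assumes [measurable]: "D \<in> borel_measurable M" "A \<in> sets M" and D: "\<And>x. 0 \<le> D x"
  shows "(LINT x:A|M. D x) = measure (density M (\<lambda>x. ennreal (D x))) A"
  unfolding set_lebesgue_integral_def measure_def using D
  by (subst integral_eq_nn_integral)
    (auto simp: emeasure_density intro!: arg_cong[where f=enn2real] nn_integral_cong
      simp: indicator_def)

text \<open>The difference of the two sides has a nonnegative integral over every Borel set, hence
  is nonnegative almost everywhere. The exceptional null set may depend on \<open>t\<close>.\<close>

lemma Omega_sub_density_rot_le:
  assumes D [measurable]: "D \<in> borel_measurable unit_lborel" and D0: "\<And>x. 0 \<le> D x"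
    and m: "density unit_lborel (\<lambda>x. ennreal (D x)) \<in> Omega_sub r" (is "?m \<in> _") and t: "0 \<le> t"
  shows "AE x in unit_lborel. D (rot t x) \<le> exp (r * t) * D x"
proof -
  interpret L: prob_space unit_lborel by (rule prob_space_unit_lborel)
  interpret m: prob_space ?m by (rule Omega_subD(1)[OF m])
  note [measurable] = measurable_rot_unit_lborel
  have "emeasure ?m (space ?m) = (\<integral>\<^sup>+x. ennreal (D x) \<partial>unit_lborel)"
    unfolding space_density by (subst emeasure_density[OF _ sets.top]) (auto intro: nn_integral_cong)
  then have "(\<integral>\<^sup>+x. ennreal (D x) \<partial>unit_lborel) = 1" using m.emeasure_space_1 by simp
  then have int: "integrable unit_lborel D"
    using D D0 by (intro integrableI_nonneg) auto
  have int': "integrable unit_lborel (\<lambda>x. D (rot t x))"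
    using integrable_distr_eq[OF measurable_rot_unit_lborel D, of t] int by (simp only: distr_rot)
  have "AE x in unit_lborel. 0 \<le> exp (r * t) * D x - D (rot t x)"
  proof (rule L.density_nonneg)
    show "integrable unit_lborel (\<lambda>x. exp (r * t) * D x - D (rot t x))"
      using int int' by auto
    fix A assume A [measurable]: "A \<in> sets unit_lborel"
    have "(LINT x:A|unit_lborel. exp (r * t) * D x - D (rot t x))
        = exp (r * t) * (LINT x:A|unit_lborel. D x) - (LINT x:A|unit_lborel. D (rot t x))"
      using integrable_mult_indicator[OF A int'] integrable_mult_indicator[OF A int, THEN integrable_mult_right, of "exp (r * t)"]
      by (subst set_integral_diff) (auto simp: set_integrable_def mult.left_commute)
    also have "(LINT x:A|unit_lborel. D x) = measure ?m A"
      by (rule set_integral_eq_measure_density[OF D A D0])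
    also have "(LINT x:A|unit_lborel. D (rot t x)) = measure ?m (rot t ` A)"
      using emeasure_density_rot[of "\<lambda>x. ennreal (D x)" A t] A D0
      by (subst set_integral_eq_measure_density) (auto simp: measure_def)
    finally show "0 \<le> (LINT x:A|unit_lborel. exp (r * t) * D x - D (rot t x))"
      using Omega_subD(4)[OF m t A] by simp
  qed
  then show ?thesis by simp
qed

text \<open>Fubini trades the null set for each angle for a null set of angles at almost every
  point; then the angle \<open>t\<close> is replaced by the endpoint \<open>x = rot (- t) y\<close>,
  so \<open>t = rot y x\<close>. Both orders of quantifiers are kept, as a point later has to be
  good as source and as target.\<close>

lemma Omega_sub_density_ae_le:
  assumes D [measurable]: "D \<in> borel_measurable unit_lborel" and D0: "\<And>x. 0 \<le> D x"
    and m: "density unit_lborel (\<lambda>x. ennreal (D x)) \<in> Omega_sub r"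
  shows "AE y in unit_lborel. AE x in unit_lborel. D y \<le> exp (r * rot y x) * D x"
    and "AE x in unit_lborel. AE y in unit_lborel. D y \<le> exp (r * rot y x) * D x"
proof -
  interpret L: prob_space unit_lborel by (rule prob_space_unit_lborel)
  interpret P: pair_sigma_finite unit_lborel unit_lborel ..
  have id: "(\<lambda>x. x) \<in> borel_measurable unit_lborel"
    by (rule borel_imp_unit_lborel) measurable
  note meas = borel_measurable_le borel_measurable_times borel_measurable_const
    measurable_compose[OF _ borel_measurable_exp]
    measurable_compose[OF measurable_fst id] measurable_compose[OF measurable_fst D]
    measurable_compose[OF measurable_snd D] measurable_compose[OF measurable_rot_pair(1) id]
    measurable_compose[OF measurable_rot_pair(2) D]
  have "AE y in unit_lborel. D y \<le> exp (r * t) * D (rot (- t) y)" if t: "0 \<le> t" for t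
    using AE_rot[OF Omega_sub_density_rot_le[OF D D0 m t], of "- t"]
    by (rule AE_mp) (auto simp: space_unit_lborel rot_rot rot_0)
  then have "AE t in unit_lborel. AE y in unit_lborel. D y \<le> exp (r * t) * D (rot (- t) y)"
    by (auto simp: space_unit_lborel)
  then have "AE y in unit_lborel. AE t in unit_lborel. D y \<le> exp (r * t) * D (rot (- t) y)"
    by (subst (asm) P.AE_commute) (intro meas)
  moreover have "AE x in unit_lborel. D y \<le> exp (r * rot y x) * D x"
    if "AE t in unit_lborel. D y \<le> exp (r * t) * D (rot (- t) y)" for y
  proof -
    have "rot (- t) y = rot (- y) t" for t by (simp add: rot_def add.commute)
    then have "AE t in unit_lborel. D y \<le> exp (r * t) * D (rot (- y) t)"
      using that by simp
    from AE_rot[OF this, of y]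
    show ?thesis
      by (rule AE_mp) (auto simp: space_unit_lborel rot_rot rot_0)
  qed
  ultimately show "AE y in unit_lborel. AE x in unit_lborel. D y \<le> exp (r * rot y x) * D x"
    by (auto elim: AE_mp)
  then show "AE x in unit_lborel. AE y in unit_lborel. D y \<le> exp (r * rot y x) * D x"
    by (subst (asm) P.AE_commute) (intro meas)
qed

text \<open>A nonempty open interval has positive length, so it is not contained in a null
  set.\<close>

lemma AE_unit_lborel_obtain:
  assumes "AE z in unit_lborel. P z" "0 \<le> a" "a < b" "b \<le> 1"
  obtains z where "a < z" "z < b" "P z"
proof -
  have "\<exists>z. a < z \<and> z < b \<and> P z"
  proof (rule ccontr)
    assume "\<not> (\<exists>z. a < z \<and> z < b \<and> P z)"
    then have "\<not> P z" if "a < z" "z < b" for z using that by blast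
    then have "AE z in unit_lborel. z \<notin> {a<..<b}"
      using assms(1) by (auto elim: AE_mp)
    then have "AE z in lborel. z \<notin> {a<..<b}"
      using assms by (auto simp: AE_restrict_space_iff)
    then have "emeasure lborel {a<..<b} = 0"
      by (subst (asm) AE_iff_measurable[of "{a<..<b}"]) auto
    then show False using assms by simp
  qed
  then show thesis using that by blast
qed

text \<open>The inequality holds between all points of a set \<open>G\<close> of full measure, by
  passing through an intermediate point. A supremum over the points of \<open>G\<close> to the left
  then extends \<open>d\<close> from \<open>G\<close> to a monotone function on the line.\<close>

lemma ae_quasimono_imp_profile:
  assumes d0: "\<And>x. 0 \<le> d x" and r: "0 \<le> r"
    and d: "AE y in unit_lborel. AE x in unit_lborel. (if y \<le> x then d y \<le> d x else d y \<le> exp r * d x)"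
    and d': "AE x in unit_lborel. AE y in unit_lborel. (if y \<le> x then d y \<le> d x else d y \<le> exp r * d x)"
  obtains g where "profile r g" "AE x in unit_lborel. d x = g x"
proof -
  define Q where "Q y x \<longleftrightarrow> (if y \<le> x then d y \<le> d x else d y \<le> exp r * d x)" for y x
  \<comment> \<open>Points related to almost every other point in both roles. Two of them need not
    be related directly, but almost every \<open>z\<close> is related to both.\<close>
  define G where "G = {z \<in> {0..<1}. (AE x in unit_lborel. Q z x) \<and> (AE y in unit_lborel. Q y z)}"
  have G: "AE z in unit_lborel. z \<in> G"
  proof -
    have "AE z in unit_lborel. (AE x in unit_lborel. Q z x) \<and> (AE y in unit_lborel. Q y z)"
      unfolding Q_def using d d' by (rule AE_conjI)
    then show ?thesis by (rule AE_mp) (auto simp: G_def space_unit_lborel)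
  qed
  have mono: "d y \<le> d x" if "y \<in> G" "x \<in> G" "y \<le> x" for x y
  proof (cases "y = x")
    case False
    have ae: "AE z in unit_lborel. Q y z \<and> Q z x"
      using that by (auto simp: G_def)
    have "0 \<le> y" "y < x" "x \<le> 1" using that False by (auto simp: G_def)
    then obtain z where "y < z" "z < x" "Q y z \<and> Q z x"
      using AE_unit_lborel_obtain[OF ae] by metis
    then show ?thesis by (auto simp: Q_def)
  qed simp
  have bound: "d y \<le> exp r * d x" if "y \<in> G" "x \<in> G" for x y
  proof (cases "y \<le> x")
    case True
    have "1 * d x \<le> exp r * d x" using r d0 by (intro mult_right_mono) auto
    then show ?thesis using mono[OF that True] by simp
  next
    case False
    \<comment> \<open>The point \<open>z\<close> is taken to the right of \<open>y\<close>, so that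
      the factor \<open>exp r\<close> enters only once, in the comparison of \<open>z\<close> with
      \<open>x\<close>.\<close>
    have ae: "AE z in unit_lborel. Q y z \<and> Q z x"
      using that by (auto simp: G_def)
    have "0 \<le> y" "y < 1" using that False by (auto simp: G_def)
    then obtain z where "y < z" "z < 1" "Q y z \<and> Q z x"
      using AE_unit_lborel_obtain[OF ae _ _ order_refl] by metis
    then show ?thesis using False by (auto simp: Q_def)
  qed
  obtain x0 where x0: "x0 \<in> G" using G by (rule AE_unit_lborel_obtain[of _ 0 1]) auto
  \<comment> \<open>The point 0 need not lie in \<open>G\<close>; this infimum serves as a lower
    bound for the value at 0.\<close>
  define p where "p = Inf (d ` G)"
  have bb: "bdd_below (d ` G)" using d0 by (auto intro!: bdd_belowI[of _ 0])
  have p0: "0 \<le> p" unfolding p_def using x0 d0 by (auto intro: cINF_greatest)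
  have p: "p \<le> d x" if "x \<in> G" for x unfolding p_def using that bb by (simp add: cINF_lower)
  have pb: "d y \<le> exp r * p" if "y \<in> G" for y
  proof -
    have "d y / exp r \<le> p" unfolding p_def
      using x0 bound[OF that] by (intro cINF_greatest) (auto simp: divide_le_eq mult.commute)
    then show ?thesis by (simp add: divide_le_eq mult.commute)
  qed
  have "1 * p \<le> exp r * p" using r p0 by (intro mult_right_mono) auto
  then have pp: "p \<le> exp r * p" by simp
  \<comment> \<open>Inserting \<open>p\<close> keeps the set nonempty where no point of
    \<open>G\<close> lies to the left, and gives \<open>p \<le> g 0\<close>, which turns the bound
    \<open>exp r * p\<close> into \<open>exp r * g 0\<close>.\<close>
  define g where "g x = Sup (insert p (d ` {y \<in> G. y \<le> x}))" for x
  have ba: "bdd_above (insert p (d ` {y \<in> G. y \<le> x}))" for x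
    using pb pp by (auto intro!: bdd_aboveI[of _ "exp r * p"])
  have pg: "p \<le> g x" for x unfolding g_def using ba by (intro cSup_upper) auto
  have "profile r g"
    unfolding profile_def
  proof (intro conjI monoI allI)
    show "g x \<le> g y" if "x \<le> y" for x y
      unfolding g_def using that ba by (intro cSup_subset_mono) auto
    show "0 \<le> g 0" using p0 pg[of 0] by simp
    fix x
    have "g x \<le> exp r * p" unfolding g_def using pb pp by (intro cSup_least) auto
    also have "\<dots> \<le> exp r * g 0" using pg[of 0] by simp
    finally show "g x \<le> exp r * g 0" .
  qed
  moreover have "d x = g x" if "x \<in> G" for x
    unfolding g_def using that mono p
    by (intro cSup_eq_maximum[symmetric]) auto
  then have "AE x in unit_lborel. d x = g x" using G by (auto elim!: AE_mp)
  ultimately show ?thesis using that by blast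
qed

lemma AE_AE_mp_space:
  assumes "AE y in M. AE x in N. P y x"
    and "\<And>x y. x \<in> space N \<Longrightarrow> y \<in> space M \<Longrightarrow> P y x \<Longrightarrow> Q y x"
  shows "AE y in M. AE x in N. Q y x"
proof -
  have "AE x in N. Q y x" if "y \<in> space M" "AE x in N. P y x" for y
    using that(2) by (rule AE_mp) (use that(1) assms(2) in auto)
  then show ?thesis using assms(1) by (auto elim: AE_mp)
qed

text \<open>The Radon-Nikodym density multiplied by \<open>exp (r * x)\<close> is quasi-monotone for
  almost all pairs, so it agrees almost everywhere with a profile.\<close>

lemma Omega_sub_imp_profile:
  assumes m: "m \<in> Omega_sub r" and r: "0 \<le> r"
  obtains g where "profile r g" "m = profile_measure r g"
proof -
  interpret L: prob_space unit_lborel by (rule prob_space_unit_lborel)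
  interpret m: prob_space m by (rule Omega_subD(1)[OF m])
  note ac = Omega_sub_absolutely_continuous[OF m]
  note sm = Omega_subD(2)[OF m]
  obtain D where D: "D \<in> borel_measurable unit_lborel"
    "AE x in unit_lborel. RN_deriv unit_lborel m x = ennreal (D x)" "\<And>x. 0 \<le> D x"
    using L.real_RN_deriv[OF m.finite_measure_axioms ac sm] by metis
  have "m = density unit_lborel (RN_deriv unit_lborel m)"
    by (rule L.density_RN_deriv[OF ac sm, symmetric])
  also have "\<dots> = density unit_lborel (\<lambda>x. ennreal (D x))"
    by (intro density_cong D(2) borel_measurable_RN_deriv measurable_compose[OF D(1) measurable_ennreal])
  finally have mD: "m = density unit_lborel (\<lambda>x. ennreal (D x))" .
  define d where "d x = exp (r * x) * D x" for x
  \<comment> \<open>The sum \<open>y + rot y x\<close> is \<open>x\<close> if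
    \<open>y \<le> x\<close> and \<open>x + 1\<close> otherwise, so the weight in \<open>d\<close>
    reduces the exponential factor to 1 or \<open>exp r\<close>.\<close>
  have Q: "(if y \<le> x then d y \<le> d x else d y \<le> exp r * d x)"
    if "D y \<le> exp (r * rot y x) * D x" "x \<in> {0..<1}" "y \<in> {0..<1}" for x y
  proof -
    have "d y \<le> exp (r * y) * (exp (r * rot y x) * D x)"
      unfolding d_def using that by (intro mult_left_mono) auto
    also have "\<dots> = exp (r * (y + rot y x)) * D x"
      by (simp add: distrib_left exp_add)
    finally have le: "d y \<le> exp (r * (y + rot y x)) * D x" .
    show ?thesis
    proof (cases "y \<le> x")
      case True
      then show ?thesis using le that by (simp add: d_def rot_in_unit)
    next
      case False
      then have "y + rot y x = 1 + x" using that by (simp add: rot_in_unit)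
      then show ?thesis using le False by (simp add: d_def distrib_left exp_add)
    qed
  qed
  note ae = Omega_sub_density_ae_le[OF D(1,3) m[unfolded mD]]
  have A: "AE y in unit_lborel. AE x in unit_lborel. (if y \<le> x then d y \<le> d x else d y \<le> exp r * d x)"
    using ae(1) by (rule AE_AE_mp_space) (rule Q, simp_all only: space_unit_lborel)
  have B: "AE x in unit_lborel. AE y in unit_lborel. (if y \<le> x then d y \<le> d x else d y \<le> exp r * d x)"
    using ae(2) by (rule AE_AE_mp_space) (rule Q, simp_all only: space_unit_lborel)
  have "0 \<le> d x" for x by (simp add: d_def D(3))
  then obtain g where g: "profile r g" "AE x in unit_lborel. d x = g x"
    using ae_quasimono_imp_profile[OF _ r A B] by blast
  have Dd: "D x = exp (- (r * x)) * d x" for x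
    by (simp add: d_def mult.assoc[symmetric] exp_add[symmetric])
  have "m = profile_measure r g"
    unfolding mD profile_measure_def
  proof (rule density_cong)
    show "AE x in unit_lborel. ennreal (D x) = ennreal (exp (- (r * x)) * g x)"
      using g(2) by (rule AE_mp) (simp add: Dd)
  qed (intro measurable_compose[OF _ measurable_ennreal] D(1) profile_measurable g(1))+
  with g(1) show ?thesis using that by blast
qed

subsection \<open>Extreme measures\<close>

text \<open>The value of \<open>W r\<close> at 0. Without the case distinction the quotient at
  \<open>r = 0\<close> would be 0, by the convention for division by zero.\<close>

definition W0 :: "real \<Rightarrow> real" where
  "W0 r = (if r = 0 then 1 else r / (1 - exp (- r)))"

text \<open>On \<open>[0,1)\<close> and for \<open>0 \<le> s < 1\<close> this is
  \<open>exp (r * x) * W r (rot s x)\<close>: a step function that jumps by the factor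
  \<open>exp r\<close> at \<open>s\<close>. For \<open>s = 0\<close> it is constant on
  \<open>[0,1)\<close>, the jump being at the point where the circle closes up.\<close>

definition rot_profile :: "real \<Rightarrow> real \<Rightarrow> real \<Rightarrow> real" where
  "rot_profile r s x = W0 r * exp (r * s - (if x < s then r else 0))"

lemma W_eq: "W r t = W0 r * exp (- (r * t))"
  by (simp add: W_def W0_def)

lemma W0_pos: "0 \<le> r \<Longrightarrow> 0 < W0 r"
  by (simp add: W0_def)

lemma rot_profile_pos: "0 \<le> r \<Longrightarrow> 0 < rot_profile r s x"
  by (simp add: rot_profile_def W0_pos)

lemma profile_rot_profile:
  assumes r: "0 \<le> r"
  shows "profile r (rot_profile r s)"
proof -
  have "W0 r * exp (r * s - (if x < s then r else 0)) \<le> W0 r * exp (r * s - (if y < s then r else 0))"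
    if "x \<le> y" for x y
    using that r W0_pos[OF r] by (intro mult_left_mono) auto
  moreover have "W0 r * exp (r * s - (if x < s then r else 0)) \<le> W0 r * exp (r + (r * s - (if 0 < s then r else 0)))" for x
    using r W0_pos[OF r] by (intro mult_left_mono) auto
  ultimately show ?thesis
    unfolding profile_def rot_profile_def using W0_pos[OF r]
    by (auto intro!: monoI simp: exp_add[symmetric] mult.left_commute[of "exp r"])
qed

lemma prob_space_m_sub:
  assumes r: "0 \<le> r"
  shows "prob_space (m_sub r)"
proof
  have W [measurable]: "W r \<in> borel_measurable borel"
    unfolding W_eq[abs_def] by measurable
  have "emeasure (m_sub r) (space (m_sub r)) = (\<integral>\<^sup>+x. ennreal (W r x) \<partial>unit_lborel)"
    unfolding m_sub_def space_density
    by (subst emeasure_density[OF measurable_compose[OF borel_imp_unit_lborel[OF W] measurable_ennreal] sets.top])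
      (auto intro: nn_integral_cong)
  also have "\<dots> = (\<integral>\<^sup>+x. ennreal (W r x) * indicator {0..<1} x \<partial>lborel)"
    by (subst nn_integral_restrict_space) auto
  \<comment> \<open>Adding the null set \<open>{1}\<close> makes the fundamental theorem for closed
    intervals applicable.\<close>
  also have "\<dots> = (\<integral>\<^sup>+x. ennreal (W r x) * indicator {0..1} x \<partial>lborel)"
    using AE_lborel_singleton[of "1 :: real"]
    by (intro nn_integral_cong_AE) (auto simp: indicator_def elim!: AE_mp)
  also have "\<dots> = 1"
  proof (cases "r = 0")
    case True
    then show ?thesis by (simp add: W_def)
  next
    case False
    let ?F = "\<lambda>x. - exp (- (r * x)) / (1 - exp (- r))"
    have "1 - exp (- r) \<noteq> 0" using r False by auto
    then have "(\<integral>\<^sup>+x. ennreal (W r x) * indicator {0..1} x \<partial>lborel) = ennreal (?F 1 - ?F 0)"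
      using r W0_pos[OF r]
      by (intro nn_integral_FTC_Icc W)
        (auto simp: W_eq W0_def False intro!: derivative_eq_intros)
    also have "?F 1 - ?F 0 = 1"
      using \<open>1 - exp (- r) \<noteq> 0\<close> by (simp add: field_simps)
    finally show ?thesis by simp
  qed
  finally show "emeasure (m_sub r) (space (m_sub r)) = 1" .
qed

lemma sets_m_sub: "sets (m_sub r) = sets circle_borel"
  by (simp add: m_sub_def sets_circle_borel)

lemma sets_comp_rot: "sets (comp_rot m s) = sets circle_borel"
  unfolding comp_rot_def by (rule sets.sets_measure_of_eq)

lemma comp_rot_m_sub:
  assumes s: "0 \<le> s" "s < 1"
  shows "comp_rot (m_sub r) s = profile_measure r (rot_profile r s)"
proof (rule measure_eqI)
  show "sets (comp_rot (m_sub r) s) = sets (profile_measure r (rot_profile r s))"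
    by (simp add: sets_comp_rot sets_profile_measure sets_circle_borel)
  fix U assume "U \<in> sets (comp_rot (m_sub r) s)"
  then have Uc: "U \<in> sets circle_borel" by (simp add: sets_comp_rot)
  then have U: "U \<in> sets unit_lborel" by (simp add: sets_circle_borel)
  have W: "(\<lambda>x. ennreal (W r x)) \<in> borel_measurable unit_lborel"
    unfolding W_eq by (rule borel_imp_unit_lborel) measurable
  have P: "(\<lambda>x. ennreal (exp (- (r * x)) * rot_profile r s x)) \<in> borel_measurable unit_lborel"
    unfolding rot_profile_def by (rule borel_imp_unit_lborel) measurable
  have eq: "W r (rot s x) = exp (- (r * x)) * rot_profile r s x" if "x \<in> {0..<1}" for x
    using that s by (simp add: W_eq rot_profile_def rot_in_unit exp_add[symmetric] algebra_simps)
  have "emeasure (comp_rot (m_sub r) s) U = emeasure (m_sub r) (rot s ` U)"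
    by (rule emeasure_comp_rot[OF sets_m_sub Uc])
  also have "\<dots> = emeasure (density unit_lborel (\<lambda>x. ennreal (W r (rot s x)))) U"
    unfolding m_sub_def by (rule emeasure_density_rot[OF W U])
  also have "density unit_lborel (\<lambda>x. ennreal (W r (rot s x))) = profile_measure r (rot_profile r s)"
    unfolding profile_measure_def
    by (intro density_cong P measurable_compose[OF measurable_rot_unit_lborel W] AE_I2)
      (simp only: eq space_unit_lborel)
  finally show "emeasure (comp_rot (m_sub r) s) U = emeasure (profile_measure r (rot_profile r s)) U" .
qed

lemma prob_space_rot_profile:
  assumes r: "0 \<le> r" and s: "0 \<le> s" "s < 1"
  shows "prob_space (profile_measure r (rot_profile r s))"
proof -
  interpret prob_space "m_sub r" by (rule prob_space_m_sub[OF r])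
  have "rot (- s) \<in> measurable (m_sub r) circle_borel"
    using measurable_rot measurable_cong_sets[OF sets_m_sub refl] by blast
  from prob_space_distr[OF this] show ?thesis
    by (simp add: comp_rot_m_sub[OF s, symmetric] comp_rot_eq_distr[OF sets_m_sub])
qed

section \<open>Rotations of \<open>m_sub r\<close> are extreme\<close>

lemma add_pos_combination_eq_zeroD:
  fixes a b p q :: real
  assumes "0 < p" "0 < q" "p * a + q * b = 0" "a \<le> 0 \<and> b \<le> 0 \<or> 0 \<le> a \<and> 0 \<le> b"
  shows "a = 0"
proof -
  have "p * a = 0"
    using assms mult_nonneg_nonneg[of p a] mult_nonneg_nonneg[of q b]
      mult_nonneg_nonpos[of p a] mult_nonneg_nonpos[of q b] by linarith
  then show ?thesis using assms by simp
qed

text \<open>On either side of \<open>s\<close> monotonicity forces both summands to be constant, and across \<open>s\<close> the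
  factor \<open>exp r\<close> attained by the sum is the largest one admissible for each summand.\<close>

lemma rot_profile_summand:
  assumes r: "0 \<le> r" and g: "profile r g" and h: "profile r h" and u: "0 < p" "0 < q"
    and eq: "AE x in unit_lborel. rot_profile r s x = p * g x + q * h x"
  obtains k where "0 \<le> k" "AE x in unit_lborel. g x = k * rot_profile r s x"
proof -
  let ?R = "rot_profile r s"
  \<comment> \<open>Proportionality of \<open>g\<close> and \<open>?R\<close> in cross-multiplied
    form, for any two points where the decomposition holds.\<close>
  have ordered: "g y * ?R x = g x * ?R y"
    if xy: "0 \<le> x" "x \<le> y" and X: "?R x = p * g x + q * h x" and Y: "?R y = p * g y + q * h y" for x y
  proof (cases "x < s \<and> s \<le> y")
    case True
    then have R: "?R y = exp r * ?R x"
      by (simp add: rot_profile_def exp_diff)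
    have le: "f y \<le> exp r * f x" if "profile r f" for f
    proof -
      have "f y \<le> exp r * f 0" using that by (simp add: profile_def)
      also have "\<dots> \<le> exp r * f x" using that xy(1) by (auto simp: profile_def dest: monoD)
      finally show ?thesis .
    qed
    have "exp r * (p * g x + q * h x) = p * g y + q * h y"
      using R X Y by simp
    then have "p * (g y - exp r * g x) + q * (h y - exp r * h x) = 0"
      by (simp add: algebra_simps)
    then have "g y - exp r * g x = 0"
      by (rule add_pos_combination_eq_zeroD[OF u]) (simp add: le[OF g] le[OF h])
    then show ?thesis using R by simp
  next
    case False
    then have R: "?R y = ?R x" using xy by (auto simp: rot_profile_def)
    have "p * (g y - g x) + q * (h y - h x) = 0"
      using R X Y by (simp add: algebra_simps)
    moreover have "g y - g x \<le> 0 \<and> h y - h x \<le> 0 \<or> 0 \<le> g y - g x \<and> 0 \<le> h y - h x"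
      using g h xy by (auto simp: profile_def dest: monoD)
    ultimately have "g y - g x = 0"
      by (rule add_pos_combination_eq_zeroD[OF u])
    then show ?thesis using R by simp
  qed
  obtain y where y: "0 < y" "?R y = p * g y + q * h y"
    using AE_unit_lborel_obtain[OF eq, of 0 1] by auto
  show thesis
  proof (rule that[of "g y / ?R y"])
    show "0 \<le> g y / ?R y"
      using profile_nonneg[OF g] y rot_profile_pos[OF r, of s y] by simp
    show "AE x in unit_lborel. g x = g y / ?R y * ?R x"
      using eq
    proof (rule AE_mp, intro AE_I2 impI)
      fix x assume x: "x \<in> space unit_lborel" "?R x = p * g x + q * h x"
      have "g y * ?R x = g x * ?R y"
        using ordered[of x y] ordered[of y x] x y by (cases "x \<le> y") (auto simp: space_unit_lborel)
      then show "g x = g y / ?R y * ?R x"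
        using rot_profile_pos[OF r, of s y] by (simp add: field_simps)
    qed
  qed
qed

lemma measure_eqI_finite:
  assumes "finite_measure M" "finite_measure N" "sets M = sets N"
    and "\<And>A. A \<in> sets M \<Longrightarrow> measure M A = measure N A"
  shows "M = N"
  using assms by (intro measure_eqI) (auto simp: finite_measure.emeasure_eq_measure)

text \<open>In a convex combination both measures have profiles, and almost everywhere the
  combination of these is \<open>rot_profile r s\<close>. Each is then proportional to it, and equal
  total mass makes both measures the given one.\<close>

lemma rot_profile_extreme:
  assumes r: "0 \<le> r" and s: "0 \<le> s" "s < 1"
  shows "profile_measure r (rot_profile r s) \<in> extreme_measures (Omega_sub r)"
proof -
  let ?R = "rot_profile r s"
  note R = profile_rot_profile[OF r, of s] and pR = prob_space_rot_profile[OF r s]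
  \<comment> \<open>Treats one summand only; it is applied twice, with the roles of the summands
    exchanged.\<close>
  have key: "profile_measure r g = profile_measure r ?R"
    if g: "profile r g" "profile_measure r g \<in> Omega_sub r" and h: "profile r h" and u: "0 < p" "0 < q"
      and eq: "\<And>U. U \<in> sets unit_lborel \<Longrightarrow>
        measure (profile_measure r ?R) U = p * measure (profile_measure r g) U + q * measure (profile_measure r h) U"
    for g h p q
  proof -
    have gh: "profile r (\<lambda>x. p * g x + q * h x)"
      using u by (intro profile_lincomb g h) auto
    have "profile_measure r ?R = profile_measure r (\<lambda>x. p * g x + q * h x)"
      using u by (intro measure_eqI_finite finite_measure_profile_measure R gh r)
        (simp_all add: sets_profile_measure eq measure_profile_measure_lincomb[OF g(1) h r])
    then have "AE x in unit_lborel. ?R x = p * g x + q * h x"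
      by (simp add: profile_measure_eq_iff[OF R gh])
    then obtain k where "0 \<le> k" "AE x in unit_lborel. g x = k * ?R x"
      by (rule rot_profile_summand[OF r g(1) h u])
    then show ?thesis
      by (intro prob_profile_measure_unique[OF g(1) R r Omega_subD(1)[OF g(2)] pR])
  qed
  have "a = b"
    if a: "a \<in> Omega_sub r" and b: "b \<in> Omega_sub r" and u: "0 < u" "u < 1"
      and eq: "\<forall>U\<in>sets (profile_measure r ?R). measure (profile_measure r ?R) U = (1 - u) * measure a U + u * measure b U"
    for a b u
  proof -
    obtain g where g: "profile r g" "a = profile_measure r g" by (rule Omega_sub_imp_profile[OF a r])
    obtain h where h: "profile r h" "b = profile_measure r h" by (rule Omega_sub_imp_profile[OF b r])
    have "a = profile_measure r ?R"
      using key[of g h "1 - u" u] a g h u eq by (simp add: sets_profile_measure)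
    moreover have "b = profile_measure r ?R"
      using key[of h g u "1 - u"] b g h u eq by (simp add: sets_profile_measure)
    ultimately show ?thesis by simp
  qed
  then show ?thesis
    unfolding extreme_measures_def using profile_measure_in_Omega[OF R r pR] by blast
qed

section \<open>Extreme measures are rotations of \<open>m_sub r\<close>\<close>

lemma profile_normalize_in_Omega:
  assumes g: "profile r g" and r: "0 \<le> r" and l: "l = measure (profile_measure r g) {0..<1}" "0 < l"
  shows "profile r (\<lambda>x. inverse l * g x)"
    and "profile_measure r (\<lambda>x. inverse l * g x) \<in> Omega_sub r"
proof -
  show p: "profile r (\<lambda>x. inverse l * g x)"
    using l by (intro profile_scale g) auto
  interpret finite_measure "profile_measure r (\<lambda>x. inverse l * g x)"
    by (rule finite_measure_profile_measure[OF p r])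
  have "measure (profile_measure r (\<lambda>x. inverse l * g x)) {0..<1} = 1"
    using l measure_profile_measure_scale[OF g r _ unit_interval_in_sets, of "inverse l"] by simp
  then have "prob_space (profile_measure r (\<lambda>x. inverse l * g x))"
    by (intro prob_spaceI) (simp only: space_profile_measure emeasure_eq_measure ennreal_1)
  then show "profile_measure r (\<lambda>x. inverse l * g x) \<in> Omega_sub r"
    by (rule profile_measure_in_Omega[OF p r])
qed

lemma profile_measure_zero_imp_AE:
  assumes g: "profile r g" and r: "0 \<le> r" and z: "measure (profile_measure r g) {0..<1} = 0"
  shows "AE x in unit_lborel. g x = 0"
proof -
  interpret finite_measure "profile_measure r g" by (rule finite_measure_profile_measure[OF g r])
  note p = profile_scale[OF g order_refl]
  have "measure (profile_measure r g) U = 0" for U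
    using z bounded_measure[of U] measure_nonneg[of "profile_measure r g" U]
    by (simp add: space_profile_measure)
  then have "profile_measure r g = profile_measure r (\<lambda>x. 0 * g x)"
    using measure_profile_measure_scale[OF g r order_refl]
    by (intro measure_eqI_finite finite_measure_profile_measure g p r)
      (simp_all only: sets_profile_measure mult_zero_left)
  then show ?thesis using profile_measure_eq_iff[OF g p] by simp
qed

text \<open>With \<open>l\<close> the mass of the first summand, the measure is the convex
  combination, with weights \<open>l\<close> and \<open>1 - l\<close>, of the two normalized
  summands, which extremality makes equal. A summand of mass zero cannot be normalized, but it
  vanishes almost everywhere.\<close>

lemma extreme_profile_summand:
  assumes r: "0 \<le> r" and g: "profile r g" and ext: "profile_measure r g \<in> extreme_measures (Omega_sub r)"
    and g1: "profile r g1" and g2: "profile r g2" and sum: "\<And>x. g x = g1 x + g2 x"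
  obtains l where "0 \<le> l" "l \<le> 1" "AE x in unit_lborel. g1 x = l * g x"
proof -
  define l where "l = measure (profile_measure r g1) {0..<1}"
  define l' where "l' = measure (profile_measure r g2) {0..<1}"
  have G: "profile_measure r g \<in> Omega_sub r" using ext by (simp add: extreme_measures_def)
  have gs: "g = (\<lambda>x. 1 * g1 x + 1 * g2 x)" using sum by auto
  have m: "measure (profile_measure r g) U = measure (profile_measure r g1) U + measure (profile_measure r g2) U"
    if "U \<in> sets unit_lborel" for U
    using measure_profile_measure_lincomb[OF g1 g2 r zero_le_one zero_le_one that] by (simp add: sum[abs_def])
  have 1: "l + l' = 1"
    using m[OF unit_interval_in_sets] prob_space.prob_space[OF Omega_subD(1)[OF G]]
    by (simp add: l_def l'_def space_profile_measure)
  have nonneg: "0 \<le> l" "0 \<le> l'" by (simp_all add: l_def l'_def)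
  consider "l = 0" | "l' = 0" | "0 < l" "0 < l'" using nonneg by linarith
  then have "AE x in unit_lborel. g1 x = l * g x"
  proof cases
    case 1
    then show ?thesis using profile_measure_zero_imp_AE[OF g1 r] by (simp add: l_def)
  next
    case 2
    then have "AE x in unit_lborel. g2 x = 0"
      using profile_measure_zero_imp_AE[OF g2 r] by (simp add: l'_def)
    then show ?thesis using 2 1 by (simp add: sum)
  next
    case 3
    let ?h1 = "\<lambda>x. inverse l * g1 x" and ?h2 = "\<lambda>x. inverse l' * g2 x"
    note h1 = profile_normalize_in_Omega[OF g1 r l_def 3(1)]
    note h2 = profile_normalize_in_Omega[OF g2 r l'_def 3(2)]
    have "measure (profile_measure r g) U
        = (1 - l) * measure (profile_measure r ?h2) U + l * measure (profile_measure r ?h1) U"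
      if U: "U \<in> sets (profile_measure r g)" for U
    proof -
      have U: "U \<in> sets unit_lborel" using U by (simp add: sets_profile_measure)
      have "1 - l = l'" using 1 by simp
      then show ?thesis
        using 3 m[OF U] measure_profile_measure_scale[OF g1 r _ U, of "inverse l"]
          measure_profile_measure_scale[OF g2 r _ U, of "inverse l'"]
        by (simp add: mult.assoc[symmetric])
    qed
    moreover have "0 < l" "l < 1" using 3 1 by auto
    ultimately have "profile_measure r ?h2 = profile_measure r ?h1"
      using ext h1(2) h2(2) unfolding extreme_measures_def by blast
    then have "AE x in unit_lborel. ?h2 x = ?h1 x"
      by (simp only: profile_measure_eq_iff[OF h2(1) h1(1)])
    then show ?thesis
    proof (rule AE_mp, intro AE_I2 impI)
      fix x assume "?h2 x = ?h1 x"
      then have "l * g2 x = l' * g1 x" using 3 by (simp add: field_simps)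
      then have "l * g x = (l + l') * g1 x" by (simp add: sum algebra_simps)
      then show "g1 x = l * g x" using 1 by simp
    qed
  qed
  then show thesis using that nonneg 1 by simp
qed

text \<open>The increments of \<open>g\<close> over a period (extended by \<open>g (x + 1) = exp r * g x\<close>) are split between
  \<open>(0,c]\<close> and \<open>(c,1]\<close>. The additive constant of each part is determined by the condition that the
  increments over a period are \<open>exp r - 1\<close> times the value at \<open>0\<close>.\<close>

lemma extreme_profile_cut:
  assumes r: "0 < r" and g: "profile r g" and ext: "profile_measure r g \<in> extreme_measures (Omega_sub r)"
    and c: "0 < c"
  defines "\<alpha> \<equiv> (g c - g 0) / (exp r - 1)"
  obtains l where "0 \<le> l" "l \<le> 1" "AE x in unit_lborel. \<alpha> + g (min x c) - g 0 = l * g x"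
proof -
  have e: "0 < exp r - 1" using r by simp
  have m: "\<And>x y. x \<le> y \<Longrightarrow> g x \<le> g y" and b: "\<And>x. g x \<le> exp r * g 0"
    using g by (auto simp: profile_def dest: monoD)
  \<comment> \<open>The first part takes the value \<open>\<alpha>\<close> at 0 and
    \<open>\<alpha> + g c - g 0\<close> from \<open>c\<close> on; the equation says that the ratio
    is exactly \<open>exp r\<close>.\<close>
  have \<alpha>: "exp r * \<alpha> = \<alpha> + g c - g 0" "0 \<le> \<alpha>"
    using e m[of 0 c] c by (auto simp: \<alpha>_def field_simps)
  \<comment> \<open>This is nonnegativity of the second part at 0.\<close>
  have \<alpha>': "\<alpha> \<le> g 0"
    using e b[of c] by (simp add: \<alpha>_def divide_le_eq algebra_simps)
  have "profile r (\<lambda>x. \<alpha> + g (min x c) - g 0)"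
    unfolding profile_def using c \<alpha> m by (auto intro!: monoI)
  moreover have "profile r (\<lambda>x. g 0 - \<alpha> + g (max x c) - g c)"
    unfolding profile_def
  proof (intro conjI monoI allI)
    fix x
    have "g 0 - \<alpha> + g (max x c) - g c \<le> g 0 - \<alpha> + exp r * g 0 - g c" using b by simp
    also have "\<dots> = exp r * (g 0 - \<alpha>)" using \<alpha> by (simp add: algebra_simps)
    finally show "g 0 - \<alpha> + g (max x c) - g c \<le> exp r * (g 0 - \<alpha> + g (max 0 c) - g c)" using c by simp
  next
    fix x y :: real assume "x \<le> y"
    then show "g 0 - \<alpha> + g (max x c) - g c \<le> g 0 - \<alpha> + g (max y c) - g c"
      using m[of "max x c" "max y c"] by simp
  qed (use c \<alpha>' in simp)
  moreover have "g x = \<alpha> + g (min x c) - g 0 + (g 0 - \<alpha> + g (max x c) - g c)" for x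
    by (simp add: min_def max_def)
  ultimately show thesis
    using that by (rule extreme_profile_summand[OF less_imp_le[OF r] g ext])
qed

text \<open>Cut at \<open>c\<close>, before an increase of \<open>g\<close>. The first part is
  constant beyond \<open>c\<close> while \<open>g\<close> is not, so the proportionality factor is
  0. The constant value, \<open>exp r\<close> times \<open>(g c - g 0) / (exp r - 1)\<close>, is
  then 0 too.\<close>

lemma extreme_profile_left:
  assumes r: "0 < r" and g: "profile r g" and ext: "profile_measure r g \<in> extreme_measures (Omega_sub r)"
    and c: "0 < c" "c < x" "x < y" "y < 1" and less: "g x < g y"
  shows "g c = g 0"
proof -
  obtain l where "0 \<le> l" and l: "AE x in unit_lborel. (g c - g 0) / (exp r - 1) + g (min x c) - g 0 = l * g x"
    using extreme_profile_cut[OF r g ext c(1)] by blast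
  have m: "\<And>x y. x \<le> y \<Longrightarrow> g x \<le> g y" using g by (auto simp: profile_def dest: monoD)
  obtain x' where x': "c < x'" "x' < x" "(g c - g 0) / (exp r - 1) + g c - g 0 = l * g x'"
    using AE_unit_lborel_obtain[OF l, of c x] c by auto
  obtain y' where y': "y < y'" "(g c - g 0) / (exp r - 1) + g c - g 0 = l * g y'"
    using AE_unit_lborel_obtain[OF l, of y 1] c by auto
  have "g x' < g y'" using less m[of x' x] m[of y y'] x' y' by simp
  then have "l = 0" using x'(3) y'(2) by simp
  then have "(g c - g 0) * exp r = 0" using x'(3) r by (simp add: field_simps)
  then show ?thesis by simp
qed

text \<open>Cut at \<open>c\<close>, after an increase of \<open>g\<close>. Before \<open>c\<close>
  the first part differs from \<open>g\<close> by a constant, so \<open>(l - 1) * g\<close> is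
  constant almost everywhere there. The increase forces \<open>l = 1\<close>, and the additive
  constant vanishes.\<close>

lemma extreme_profile_right:
  assumes r: "0 < r" and g: "profile r g" and ext: "profile_measure r g \<in> extreme_measures (Omega_sub r)"
    and c: "0 < x" "x < y" "y < c" "c < 1" and less: "g x < g y"
  shows "g c = exp r * g 0"
proof -
  have "0 < c" using c by simp
  then obtain l where l: "AE x in unit_lborel. (g c - g 0) / (exp r - 1) + g (min x c) - g 0 = l * g x"
    using extreme_profile_cut[OF r g ext] by blast
  have m: "\<And>x y. x \<le> y \<Longrightarrow> g x \<le> g y" using g by (auto simp: profile_def dest: monoD)
  obtain x' where x': "x' < x" "(g c - g 0) / (exp r - 1) - g 0 = (l - 1) * g x'"
    using AE_unit_lborel_obtain[OF l, of 0 x] c by (auto simp: algebra_simps)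
  obtain y' where y': "y < y'" "y' < c" "(g c - g 0) / (exp r - 1) - g 0 = (l - 1) * g y'"
    using AE_unit_lborel_obtain[OF l, of y c] c by (auto simp: algebra_simps)
  have "g x' < g y'" using less m[of x' x] m[of y y'] x' y' by simp
  then have "l - 1 = 0" using x'(2) y'(3) by simp
  then have "(g c - g 0) / (exp r - 1) = g 0" using x'(2) by simp
  then show ?thesis using r by (simp add: field_simps)
qed

lemma AE_unit_lborel_neq: "AE x in unit_lborel. x \<noteq> a"
  using AE_lborel_singleton[of a] by (auto simp: AE_restrict_space_iff)

text \<open>By the two preceding lemmas \<open>g\<close> has its least value \<open>g 0\<close>
  before any increase and its greatest value \<open>exp r * g 0\<close> after it, which leaves room
  for a single jump.\<close>

lemma extreme_profile_step:
  assumes r: "0 \<le> r" and g: "profile r g" and ext: "profile_measure r g \<in> extreme_measures (Omega_sub r)"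
  obtains k s where "0 \<le> k" "0 \<le> s" "s < 1" "AE x in unit_lborel. g x = k * rot_profile r s x"
proof (cases "\<exists>x y. 0 < x \<and> x < y \<and> y < 1 \<and> g x < g y")
  \<comment> \<open>Here \<open>g\<close> is constant on \<open>(0,1)\<close>, which is the case
    \<open>s = 0\<close>. This covers \<open>r = 0\<close>.\<close>
  case False
  have m: "\<And>x y. x \<le> y \<Longrightarrow> g x \<le> g y" using g by (auto simp: profile_def dest: monoD)
  have le: "g y \<le> g x" if "0 < x" "x < y" "y < 1" for x y
    using False that by (meson not_le)
  have const: "g x = g (1/2)" if "0 < x" "x < 1" for x
  proof (cases x "1/2 :: real" rule: linorder_cases)
    case less
    then show ?thesis using le[of x "1/2"] that m[of x "1/2"] by simp
  next
    case greater
    then show ?thesis using le[of "1/2" x] that m[of "1/2" x] by simp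
  qed (simp only:)
  have "AE x in unit_lborel. g x = g (1/2) / W0 r * rot_profile r 0 x"
    using AE_unit_lborel_neq[of 0]
  proof (rule AE_mp, intro AE_I2 impI)
    fix x :: real assume x: "x \<in> space unit_lborel" "x \<noteq> 0"
    then have "g x = g (1/2)" by (intro const) (auto simp: space_unit_lborel)
    then show "g x = g (1/2) / W0 r * rot_profile r 0 x"
      using x W0_pos[OF r] by (simp add: rot_profile_def space_unit_lborel)
  qed
  then show thesis
    using that[of "g (1/2) / W0 r" 0] profile_nonneg[OF g, of "1/2"] W0_pos[OF r] by simp
next
  case True
  then obtain x y where xy: "0 < x" "x < y" "y < 1" "g x < g y" by blast
  have m: "\<And>x y. x \<le> y \<Longrightarrow> g x \<le> g y" and b: "\<And>x. g x \<le> exp r * g 0"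
    using g by (auto simp: profile_def dest: monoD)
  have g0: "g 0 < exp r * g 0" using xy m[of 0 x] b[of y] by simp
  then have "r \<noteq> 0" by auto
  then have r0: "0 < r" using r by simp
  \<comment> \<open>The jump is located at the supremum of the points where \<open>g\<close> still
    has its initial value.\<close>
  define Z where "Z = {z. 0 < z \<and> z < 1 \<and> g z = g 0}"
  have x2: "x / 2 \<in> Z"
    using extreme_profile_left[OF r0 g ext _ _ xy(2-4), of "x / 2"] xy by (simp add: Z_def)
  have Zy: "z \<le> y" if "z \<in> Z" for z
  proof (rule ccontr)
    assume "\<not> z \<le> y"
    then have "g z = exp r * g 0"
      using extreme_profile_right[OF r0 g ext xy(1,2) _ _ xy(4), of z] that by (simp add: Z_def)
    moreover have "g z = g 0" using that by (simp add: Z_def)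
    ultimately show False using g0 by linarith
  qed
  have bdd: "bdd_above Z" using Zy by (rule bdd_aboveI)
  define s where "s = Sup Z"
  have s: "0 < s" "s < 1"
  proof -
    have "x / 2 \<le> s" unfolding s_def by (rule cSup_upper[OF x2 bdd])
    then show "0 < s" using xy by simp
    have "s \<le> y" unfolding s_def using x2 Zy by (intro cSup_least) auto
    then show "s < 1" using xy by simp
  qed
  have below: "g c = g 0" if c: "0 < c" "c < s" for c
  proof -
    obtain z where "z \<in> Z" "c < z"
      using c x2 bdd less_cSup_iff[of Z c] unfolding s_def by auto
    then show ?thesis using m[of 0 c] m[of c z] c by (simp add: Z_def)
  qed
  have above: "g c = exp r * g 0" if c: "s < c" "c < 1" for c
  proof -
    \<comment> \<open>Since \<open>z\<close> lies beyond the supremum of \<open>Z\<close>,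
      \<open>g\<close> has increased between \<open>s / 2\<close> and \<open>z\<close>, and
      \<open>c\<close> comes after this increase.\<close>
    obtain z where z: "s < z" "z < c" using dense[OF c(1)] by blast
    then have "z \<notin> Z" using cSup_upper[OF _ bdd] unfolding s_def by fastforce
    then have "g 0 < g z" using z c s m[of 0 z] by (auto simp: Z_def)
    moreover have "g (s / 2) = g 0" using s by (intro below) auto
    ultimately show ?thesis
      using extreme_profile_right[OF r0 g ext, of "s / 2" z c] s z c by simp
  qed
  \<comment> \<open>Chosen so that both sides agree to the left of \<open>s\<close>, where
    \<open>rot_profile r s\<close> equals the denominator.\<close>
  define k where "k = g 0 / (W0 r * exp (r * s - r))"
  have W: "0 < W0 r * exp (r * s - r)" using W0_pos[OF r] by simp
  have k: "g 0 = k * (W0 r * exp (r * s - r))" using W0_pos[OF r] by (simp add: k_def)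
  \<comment> \<open>The value at the jump is not determined, and \<open>below\<close> does not cover
    0; both points are null.\<close>
  have "AE x in unit_lborel. x \<noteq> 0 \<and> x \<noteq> s"
    by (intro AE_conjI AE_unit_lborel_neq)
  then have "AE x in unit_lborel. g x = k * rot_profile r s x"
  proof (rule AE_mp, intro AE_I2 impI)
    fix v assume v: "v \<in> space unit_lborel" "v \<noteq> 0 \<and> v \<noteq> s"
    show "g v = k * rot_profile r s v"
    proof (cases "v < s")
      case True
      then have "g v = g 0" using v by (intro below) (auto simp: space_unit_lborel)
      then show ?thesis using True k by (simp add: rot_profile_def)
    next
      case False
      then have "g v = exp r * g 0" using v by (intro above) (auto simp: space_unit_lborel)
      then show ?thesis using False by (simp add: k rot_profile_def exp_diff)
    qed
  qed
  moreover have "0 \<le> k" using W profile_nonneg[OF g, of 0] by (simp add: k_def)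
  ultimately show thesis using that[of k s] s by simp
qed

theorem proposition7p5:
  fixes r :: real
  assumes "0 \<le> r"
  shows "{comp_rot (m_sub r) s | s. 0 \<le> s \<and> s < 1} = extreme_measures (Omega_sub r)"
proof (intro Set.equalityI subsetI)
  fix m assume "m \<in> {comp_rot (m_sub r) s | s. 0 \<le> s \<and> s < 1}"
  then show "m \<in> extreme_measures (Omega_sub r)"
    using rot_profile_extreme[OF assms] comp_rot_m_sub by auto
next
  fix m assume m: "m \<in> extreme_measures (Omega_sub r)"
  then have O: "m \<in> Omega_sub r" by (simp add: extreme_measures_def)
  then obtain g where g: "profile r g" "m = profile_measure r g"
    by (rule Omega_sub_imp_profile[OF _ assms])
  obtain k s where ks: "0 \<le> k" "0 \<le> s" "s < 1" "AE x in unit_lborel. g x = k * rot_profile r s x"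
    using extreme_profile_step[OF assms g(1)] m g(2) by blast
  \<comment> \<open>Both sides are probability measures with proportional profiles, so the factor
    \<open>k\<close> is 1.\<close>
  have "m = profile_measure r (rot_profile r s)"
    unfolding g(2)
    using Omega_subD(1)[OF O] g(2) ks
    by (intro prob_profile_measure_unique[OF g(1) profile_rot_profile[OF assms] assms _
        prob_space_rot_profile[OF assms ks(2,3)] ks(1,4)]) simp
  then have "m = comp_rot (m_sub r) s"
    using comp_rot_m_sub ks(2,3) by simp
  then show "m \<in> {comp_rot (m_sub r) s | s. 0 \<le> s \<and> s < 1}"
    using ks(2,3) by blast
qed

end
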